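(* Let $\mathcal{F}=\{A_1,\dots,A_m\}$ be a family of $m$ distinct subsets of $[n]$ such that $|A_i|=k$ for all $i$. Suppose there exist $\ell_1,\ell_2\ge 0$ such that for all $i\ne j$: if $|i-j|=1$ then $|A_i\cap A_j|=\ell_1$, and if $|i-j|\ge 2$ then $|A_i\cap A_j|=\ell_2$. Then $m\le n$.
   Context: $[n]=\{1,\dots,n\}$. The sets in the family are indexed by $1,\dots,m$, and the intersection condition depends on the index difference $|i-j|$. *)

theory Defs
  imports Main
begin

end

theory Submission
  imports Defs
begin

text \<open>
  Suppose m > n. Then the indicator vectors of the sets satisfy a nontrivial integer relation with
  coefficients \<open>x i\<close>. Pairing it with the all-ones vector gives \<open>\<Sum>i. x i = 0\<close>, because all sets have
  the same size; pairing it with \<open>A j\<close> then gives \<open>a * x j + b * (x (j - 1) + x (j + 1)) = 0\<close>, where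
  \<open>a = k - l2 > 0\<close>, \<open>b = l1 - l2\<close> and x vanishes at 0 and m + 1. A descent on
  divisibility shows that b divides a, and looking at an entry of largest modulus shows
  \<open>\<bar>a\<bar> < 2 * \<bar>b\<bar>\<close>. Hence \<open>\<bar>a\<bar> = \<bar>b\<bar>\<close>, and as \<open>l1 < k\<close> this forces \<open>b = - a\<close>, that is,
  \<open>k + l1 = 2 * l2\<close>. In that case \<open>A 1 \<union> A 2 \<union> A 3\<close> already has at least 5 elements, while
  for m \<ge> 7 the vector with coefficients (1,1,1,0,-1,-1,-1) would have squared norm
  \<open>- 2 * a\<close>. The remaining case m = 6 has no nonzero solution x.
\<close>

section \<open>Linear relations over an integral domain\<close>

text \<open>Gaussian elimination, one equation per induction step. It is fraction-free, so integer
  systems get integer solutions.\<close>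

lemma homogeneous_system_nontrivial_solution:
  fixes c :: "'e \<Rightarrow> 'u \<Rightarrow> 'a::idom"
  assumes "finite J" "card J < card I"
  shows "\<exists>x. (\<exists>i\<in>I. x i \<noteq> 0) \<and> (\<forall>j\<in>J. (\<Sum>i\<in>I. c j i * x i) = 0)"
  using assms
proof (induction J arbitrary: I c rule: finite_induct)
  case empty
  then have "I \<noteq> {}" by auto
  then show ?case by (intro exI[of _ "\<lambda>_. 1"]) auto
next
  case (insert j J)
  have "finite I" using insert.prems by (metis card.infinite not_less_zero)
  show ?case
  proof (cases "\<forall>i\<in>I. c j i = 0")
    case True
    have "card J < card I" using insert by simp
    from insert.IH[OF this] obtain x
      where "\<exists>i\<in>I. x i \<noteq> 0" "\<forall>j\<in>J. (\<Sum>i\<in>I. c j i * x i) = 0" by blast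
    with True show ?thesis by (intro exI[of _ x]) auto
  next
    case False
    then obtain p where p: "p \<in> I" "c j p \<noteq> 0" by blast
    let ?I = "I - {p}"
    have "card J < card ?I" using insert p \<open>finite I\<close> by simp
    \<comment> \<open>Cross-multiplying with equation \<open>j\<close> cancels the pivot unknown
      \<open>p\<close> without division.\<close>
    from insert.IH[OF this, of "\<lambda>j' i. c j p * c j' i - c j' p * c j i"] obtain x
      where x: "\<exists>i\<in>?I. x i \<noteq> 0"
        and sol: "\<And>j'. j' \<in> J \<Longrightarrow> (\<Sum>i\<in>?I. (c j p * c j' i - c j' p * c j i) * x i) = 0"
      by blast
    \<comment> \<open>Back substitution: scaling the other unknowns by the pivot
      \<open>c j p\<close> lets the value at \<open>p\<close> satisfy equation \<open>j\<close>
      inside the ring.\<close>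
    define y where "y i = (if i = p then - (\<Sum>i\<in>?I. c j i * x i) else c j p * x i)" for i
    have split: "(\<Sum>i\<in>I. d i * y i)
        = c j p * (\<Sum>i\<in>?I. d i * x i) - d p * (\<Sum>i\<in>?I. c j i * x i)" for d
    proof -
      have "(\<Sum>i\<in>I. d i * y i) = d p * y p + (\<Sum>i\<in>?I. d i * y i)"
        using \<open>finite I\<close> p by (simp add: sum.remove)
      also have "(\<Sum>i\<in>?I. d i * y i) = c j p * (\<Sum>i\<in>?I. d i * x i)"
        unfolding sum_distrib_left by (rule sum.cong) (auto simp: y_def)
      finally show ?thesis by (simp add: y_def)
    qed
    have "(\<Sum>i\<in>I. c j' i * y i) = 0" if "j' \<in> J" for j'
      using sol[OF that] unfolding split
      by (simp add: left_diff_distrib sum_subtractf sum_distrib_left mult.assoc)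
    moreover have "(\<Sum>i\<in>I. c j i * y i) = 0" unfolding split by simp
    moreover have "\<exists>i\<in>I. y i \<noteq> 0" using x p by (auto simp: y_def)
    ultimately show ?thesis by blast
  qed
qed

section \<open>Integer solutions of the recurrence on a path\<close>

text \<open>After division by the gcd, a common divisor \<open>b' ^ N\<close> of all entries
  improves to \<open>b' ^ Suc N\<close>, since \<open>b'\<close> is coprime to \<open>a'\<close>. A
  nonzero entry thus forces \<open>b'\<close> to be a unit.\<close>

lemma path_recurrence_dvd:
  fixes x :: "nat \<Rightarrow> int" and a b :: int
  assumes rec: "\<And>i. i \<in> {1..m} \<Longrightarrow> a * x i + b * (x (i - 1) + x (i + 1)) = 0"
    and zero: "\<And>i. i \<notin> {1..m} \<Longrightarrow> x i = 0"
    and nz: "x p \<noteq> 0" and b: "b \<noteq> 0"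
  shows "b dvd a"
proof -
  obtain a' b' g where ab: "a = a' * g" "b = b' * g" "coprime a' b'"
    using b gcd_coprime_exists[of a b] by auto
  have rec': "a' * x i = - b' * (x (i - 1) + x (i + 1))" if "i \<in> {1..m}" for i
  proof -
    have "g * (a' * x i + b' * (x (i - 1) + x (i + 1))) = 0"
      using rec[OF that] unfolding ab(1,2) by (simp add: algebra_simps)
    moreover have "g \<noteq> 0" using b ab(2) by auto
    ultimately show ?thesis by simp
  qed
  have pow: "b' ^ N dvd x i" for N i
  proof (induction N arbitrary: i)
    case (Suc N)
    show ?case
    proof (cases "i \<in> {1..m}")
      case True
      have "b' ^ N dvd x (i - 1) + x (i + 1)" using Suc by simp
      then have "b' ^ Suc N dvd a' * x i" unfolding rec'[OF True] by (simp add: mult_dvd_mono)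
      moreover have "coprime (b' ^ Suc N) a'" using ab(3) by (metis coprime_commute coprime_power_left_iff)
      ultimately show ?thesis using coprime_dvd_mult_right_iff by blast
    qed (simp add: zero)
  qed simp
  have "\<bar>b'\<bar> = 1"
  proof (rule ccontr)
    assume "\<bar>b'\<bar> \<noteq> 1"
    moreover have "b' \<noteq> 0" using b ab(2) by auto
    ultimately have "2 \<le> \<bar>b'\<bar>" by linarith
    define N where "N = nat \<bar>x p\<bar>"
    have "\<bar>x p\<bar> < 2 ^ N" using less_exp[of N] unfolding N_def
      by (metis abs_ge_zero int_nat_eq of_nat_less_numeral_power_cancel_iff)
    also have "\<dots> \<le> \<bar>b'\<bar> ^ N" using \<open>2 \<le> \<bar>b'\<bar>\<close> by (simp add: power_mono)
    also have "\<dots> \<le> \<bar>x p\<bar>" using dvd_imp_le_int[OF nz pow[of N p]] by (simp add: power_abs)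
    finally show False by simp
  qed
  then have "b' dvd a'" by (metis dvd_trans abs_dvd_iff one_dvd)
  then show ?thesis using ab(1,2) by (metis mult_dvd_mono dvd_refl)
qed

lemma path_recurrence_bound:
  fixes x :: "nat \<Rightarrow> int" and a b :: int
  assumes rec: "\<And>i. i \<in> {1..m} \<Longrightarrow> a * x i + b * (x (i - 1) + x (i + 1)) = 0"
    and zero: "\<And>i. i \<notin> {1..m} \<Longrightarrow> x i = 0"
    and nz: "x p \<noteq> 0" and b: "b \<noteq> 0"
  shows "\<bar>a\<bar> < 2 * \<bar>b\<bar>"
proof -
  define M where "M = Max ((\<lambda>i. \<bar>x i\<bar>) ` {0..m})"
  have pm: "p \<in> {0..m}" using zero nz by fastforce
  have le: "\<bar>x i\<bar> \<le> M" for i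
  proof (cases "i \<in> {0..m}")
    case True
    then show ?thesis unfolding M_def by (intro Max_ge) auto
  next
    case False
    then have "\<bar>x i\<bar> \<le> \<bar>x p\<bar>" using zero[of i] by simp
    also have "\<dots> \<le> M" unfolding M_def using pm by (intro Max_ge) auto
    finally show ?thesis .
  qed
  have "M \<in> (\<lambda>i. \<bar>x i\<bar>) ` {0..m}" unfolding M_def by (intro Max_in) auto
  then have ex: "\<exists>i. \<bar>x i\<bar> = M" by auto
  \<comment> \<open>Taking the leftmost entry of maximal modulus makes its left neighbour strictly
    smaller, hence the strict bound.\<close>
  define q where "q = (LEAST i. \<bar>x i\<bar> = M)"
  have q: "\<bar>x q\<bar> = M" using LeastI_ex[OF ex] unfolding q_def .
  have M: "M > 0" using le[of p] nz by linarith
  then have qm: "q \<in> {1..m}" using zero[of q] q by fastforce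
  have "\<bar>x (q - 1)\<bar> \<noteq> M" using not_less_Least[of "q - 1" "\<lambda>i. \<bar>x i\<bar> = M"] qm
    unfolding q_def[symmetric] by simp
  then have lt: "\<bar>x (q - 1) + x (q + 1)\<bar> < 2 * M" using le[of "q - 1"] le[of "q + 1"] by linarith
  have "\<bar>a\<bar> * M = \<bar>b\<bar> * \<bar>x (q - 1) + x (q + 1)\<bar>"
    using rec[OF qm] q by (metis abs_mult abs_minus eq_neg_iff_add_eq_0)
  also have "\<dots> < \<bar>b\<bar> * (2 * M)" using lt b by simp
  finally show ?thesis using M by simp
qed

section \<open>Gram matrices of set families\<close>

text \<open>Double counting of incidences. If the indicator vectors satisfy a relation with
  coefficients \<open>x\<close>, every inner sum on the right vanishes.\<close>

lemma sum_card_Int_eq: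
  fixes x :: "'i \<Rightarrow> int"
  assumes "finite I" "finite B"
  shows "(\<Sum>i\<in>I. x i * int (card (A i \<inter> B))) = (\<Sum>t\<in>B. \<Sum>i\<in>I. of_bool (t \<in> A i) * x i)"
proof -
  have "x i * int (card (A i \<inter> B)) = (\<Sum>t\<in>B. of_bool (t \<in> A i) * x i)" for i
  proof -
    have "(\<Sum>t\<in>B. of_bool (t \<in> A i)) = int (card (A i \<inter> B))"
      using assms by (simp add: Int_commute)
    then show ?thesis unfolding sum_distrib_right[symmetric] by (simp only: mult.commute)
  qed
  then show ?thesis by (simp add: sum.swap[of _ B I])
qed

text \<open>The form is the squared norm of the combination of indicator vectors with coefficients
  \<open>x\<close>; \<open>f t\<close> is its coordinate at \<open>t\<close>.\<close>

lemma Gram_quadratic_form_nonneg: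
  fixes x :: "'i \<Rightarrow> int"
  assumes "finite I" "\<And>i. i \<in> I \<Longrightarrow> finite (A i)"
  shows "0 \<le> (\<Sum>j\<in>I. x j * (\<Sum>i\<in>I. x i * int (card (A i \<inter> A j))))"
proof -
  define U where "U = (\<Union>i\<in>I. A i)"
  have U: "finite U" using assms by (auto simp: U_def)
  define f where "f t = (\<Sum>i\<in>I. of_bool (t \<in> A i) * x i)" for t
  have "(\<Sum>j\<in>I. x j * (\<Sum>i\<in>I. x i * int (card (A i \<inter> A j)))) = (\<Sum>j\<in>I. x j * (\<Sum>t\<in>A j. f t))"
    using assms by (simp add: sum_card_Int_eq f_def)
  also have "\<dots> = (\<Sum>j\<in>I. \<Sum>t\<in>U. of_bool (t \<in> A j) * x j * f t)"
  proof (rule sum.cong)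
    fix j assume "j \<in> I"
    then have "A j \<subseteq> U" by (auto simp: U_def)
    then have "(\<Sum>t\<in>A j. f t) = (\<Sum>t\<in>U. of_bool (t \<in> A j) * f t)"
      using U by (intro sum.mono_neutral_cong_left) auto
    then show "x j * (\<Sum>t\<in>A j. f t) = (\<Sum>t\<in>U. of_bool (t \<in> A j) * x j * f t)"
      by (simp add: sum_distrib_left mult.assoc mult.left_commute)
  qed simp
  also have "\<dots> = (\<Sum>t\<in>U. f t * f t)"
    by (subst sum.swap) (simp add: f_def sum_distrib_right)
  finally show ?thesis by (simp add: sum_nonneg)
qed

lemma card_Int_less_of_distinct:
  assumes "finite A" "finite B" "card A = k" "card B = k" "A \<noteq> B"
  shows "card (A \<inter> B) < k"
proof -
  have "A \<inter> B \<noteq> A"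
    using assms card_subset_eq[of B A] by auto
  then have "A \<inter> B \<subset> A" by blast
  then show ?thesis using assms psubset_card_mono by blast
qed

text \<open>The matrix is \<open>c\<close> times all-ones, plus \<open>a\<close> times the identity,
  plus \<open>b\<close> times the adjacency matrix of a path. Extending \<open>x\<close> by zero
  spares the end rows a special form.\<close>

lemma sum_path_Gram_row:
  fixes x :: "nat \<Rightarrow> int" and a b c :: int
  assumes "j \<in> {1..m}" and zero: "\<And>i. i \<notin> {1..m} \<Longrightarrow> x i = 0"
  shows "(\<Sum>i\<in>{1..m}. x i * (c + (if i = j then a else 0) + (if i + 1 = j \<or> i = j + 1 then b else 0)))
    = c * (\<Sum>i\<in>{1..m}. x i) + a * x j + b * (x (j - 1) + x (j + 1))"
proof -
  have "(\<Sum>i\<in>{1..m}. x i * (c + (if i = j then a else 0) + (if i + 1 = j \<or> i = j + 1 then b else 0)))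
      = (\<Sum>i\<in>{1..m}. c * x i + (if i = j then a * x i else 0)
          + (if i = j - 1 then b * x i else 0) + (if i = j + 1 then b * x i else 0))"
    using assms(1) by (intro sum.cong) (auto simp: algebra_simps)
  also have "\<dots> = c * (\<Sum>i\<in>{1..m}. x i) + a * x j + b * (x (j - 1) + x (j + 1))"
    using assms(1) zero[of "j - 1"] zero[of "j + 1"]
    by (simp add: sum.distrib sum_distrib_left[symmetric] distrib_left del: One_nat_def)
  finally show ?thesis .
qed

theorem theorem1p7:
  fixes n m k :: nat and A :: "nat \<Rightarrow> nat set"
  assumes "n \<ge> 1"
    and "\<forall>i\<in>{1..m}. A i \<subseteq> {1..n}"
    and "inj_on A {1..m}"
    and "\<forall>i\<in>{1..m}. card (A i) = k"
    and "\<exists>l1 l2 :: nat. \<forall>i\<in>{1..m}. \<forall>j\<in>{1..m}. i \<noteq> j \<longrightarrow>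
           (\<bar>int i - int j\<bar> = 1 \<longrightarrow> card (A i \<inter> A j) = l1) \<and>
           (\<bar>int i - int j\<bar> \<ge> 2 \<longrightarrow> card (A i \<inter> A j) = l2)"
  shows "m \<le> n"
proof (rule ccontr)
  assume "\<not> m \<le> n"
  then have mn: "n < m" by simp
  have sub: "A i \<subseteq> {1..n}" and cardk: "card (A i) = k" if "i \<in> {1..m}" for i
    using that assms by auto
  have fin: "finite (A i)" if "i \<in> {1..m}" for i
    using sub[OF that] finite_subset by blast
  have less: "card (A i \<inter> A j) < k" if "i \<in> {1..m}" "j \<in> {1..m}" "i \<noteq> j" for i j
    using that cardk fin inj_onD[OF assms(3)] by (intro card_Int_less_of_distinct) auto

  \<comment> \<open>For \<open>m \<le> 2\<close> the value of \<open>l2\<close> is unconstrained, so we are free to take it equal to \<open>l1\<close>.\<close>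
  obtain l1 l2 where near: "\<And>i j. \<lbrakk>i \<in> {1..m}; j \<in> {1..m}; i + 1 = j \<or> i = j + 1\<rbrakk> \<Longrightarrow> card (A i \<inter> A j) = l1"
    and far: "\<And>i j. \<lbrakk>i \<in> {1..m}; j \<in> {1..m}; i + 2 \<le> j \<or> j + 2 \<le> i\<rbrakk> \<Longrightarrow> card (A i \<inter> A j) = l2"
    and small: "m \<le> 2 \<Longrightarrow> l2 = l1"
  proof -
    from assms(5) obtain l1 l2 where "\<forall>i\<in>{1..m}. \<forall>j\<in>{1..m}. i \<noteq> j \<longrightarrow>
           (\<bar>int i - int j\<bar> = 1 \<longrightarrow> card (A i \<inter> A j) = l1) \<and>
           (\<bar>int i - int j\<bar> \<ge> 2 \<longrightarrow> card (A i \<inter> A j) = l2)"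
      by (elim exE)
    note * = this[rule_format]
    show thesis
    proof (rule that[of l1 "if m \<le> 2 then l1 else l2"])
      fix i j assume "i \<in> {1..m}" "j \<in> {1..m}" "i + 1 = j \<or> i = j + 1"
      then show "card (A i \<inter> A j) = l1" using *[of i j] by auto
    next
      fix i j assume "i \<in> {1..m}" "j \<in> {1..m}" "i + 2 \<le> j \<or> j + 2 \<le> i"
      then show "card (A i \<inter> A j) = (if m \<le> 2 then l1 else l2)" using *[of i j] by auto
    qed simp
  qed

  define a b where "a = int k - int l2" and "b = int l1 - int l2"
  have m2: "m \<ge> 2" using mn assms(1) by simp
  have l1k: "l1 < k" using less[of 1 2] near[of 1 2] m2 by simp
  have l2k: "l2 < k"
  proof (cases "m \<le> 2")
    case False
    then show ?thesis using less[of 1 3] far[of 1 3] by simp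
  qed (use small l1k in simp)
  have gram: "int (card (A i \<inter> A j))
      = int l2 + (if i = j then a else 0) + (if i + 1 = j \<or> i = j + 1 then b else 0)"
    if "i \<in> {1..m}" "j \<in> {1..m}" for i j
  proof -
    consider "i = j" | "i + 1 = j \<or> i = j + 1" | "i + 2 \<le> j \<or> j + 2 \<le> i" by linarith
    then show ?thesis
      by cases (use that near[of i j] far[of i j] cardk[of i] in \<open>auto simp: a_def b_def\<close>)
  qed

  obtain x0 :: "nat \<Rightarrow> int" where x0: "\<exists>i\<in>{1..m}. x0 i \<noteq> 0"
    and rel0: "\<forall>t\<in>{1..n}. (\<Sum>i\<in>{1..m}. of_bool (t \<in> A i) * x0 i) = 0"
    using homogeneous_system_nontrivial_solution[of "{1..n}" "{1..m}" "\<lambda>t i. of_bool (t \<in> A i)"] mn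
    by auto
  define x where "x i = (if i \<in> {1..m} then x0 i else 0)" for i
  have zero: "x i = 0" if "i \<notin> {1..m}" for i using that unfolding x_def by auto
  obtain p where p: "x p \<noteq> 0" using x0 by (metis x_def)
  have rel: "(\<Sum>i\<in>{1..m}. of_bool (t \<in> A i) * x i) = 0" if "t \<in> {1..n}" for t
    using rel0 that by (simp add: x_def)
  have orth: "(\<Sum>i\<in>{1..m}. x i * int (card (A i \<inter> B))) = 0" if "B \<subseteq> {1..n}" for B
    using that rel finite_subset[OF that] by (simp add: sum_card_Int_eq subset_iff)
  have "(\<Sum>i\<in>{1..m}. x i * int k) = (\<Sum>i\<in>{1..m}. x i * int (card (A i \<inter> {1..n})))"
    using sub cardk by (intro sum.cong) (auto simp: Int_absorb2)
  then have "(\<Sum>i\<in>{1..m}. x i) = 0"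
    using orth[of "{1..n}"] l1k by (simp add: sum_distrib_right[symmetric])
  then have rec: "a * x j + b * (x (j - 1) + x (j + 1)) = 0" if "j \<in> {1..m}" for j
    using orth[OF sub[OF that]] gram[OF _ that] sum_path_Gram_row[where x = x, OF that zero, of "int l2" a b]
    by (simp del: One_nat_def)

  have a0: "a > 0" using l2k by (simp add: a_def)
  \<comment> \<open>With b = 0 the recurrence would read \<open>a * x p = 0\<close>.\<close>
  have b0: "b \<noteq> 0"
    using rec[of p] zero[of p] p a0 by (cases "p \<in> {1..m}") auto
  have m3: "m \<ge> 3" using small b0 by (force simp: b_def)
  obtain q where q: "a = b * q" using path_recurrence_dvd[where x = x and m = m, OF rec zero p b0] by blast
  have "\<bar>b\<bar> * \<bar>q\<bar> < \<bar>b\<bar> * 2"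
    using path_recurrence_bound[where x = x and m = m, OF rec zero p b0] unfolding q by (simp add: abs_mult)
  then have "\<bar>q\<bar> < 2" using b0 by simp
  moreover have "q \<noteq> 0" using a0 q by auto
  moreover have "q \<noteq> 1" using q l1k by (auto simp: a_def b_def)
  ultimately have "q = - 1" by linarith
  then have ba: "b = - a" using q by simp
  then have kl: "k + l1 = 2 * l2" by (simp add: a_def b_def)

  \<comment> \<open>Put d = k - l2 = l2 - l1 \<ge> 1, so k = l1 + 2d. Then
    \<open>A 1 \<union> A 2\<close> has l1 + 4d elements, enough if l1 > 0. If l1 = 0, then
    \<open>A 2\<close> is disjoint from \<open>A 1 \<union> A 3\<close>, and the three sets cover 2d
    + 3d elements.\<close>
  have "n \<ge> 5"
  proof -
    have U12: "card (A 1 \<union> A 2) + l1 = 2 * k"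
      using card_Un_Int[of "A 1" "A 2"] fin cardk near[of 1 2] m3 by simp
    have U13: "card (A 1 \<union> A 3) + l2 = 2 * k"
      using card_Un_Int[of "A 1" "A 3"] fin cardk far[of 1 3] m3 by simp
    have le12: "card (A 1 \<union> A 2) \<le> n"
      using card_mono[of "{1..n}" "A 1 \<union> A 2"] sub m3 by simp
    show ?thesis
    proof (cases "l1 = 0")
      case True
      then have "A 2 \<inter> (A 1 \<union> A 3) = {}"
        using near[of 1 2] near[of 2 3] fin[of 2] m3 by auto
      then have "card (A 2 \<union> (A 1 \<union> A 3)) = k + card (A 1 \<union> A 3)"
        using fin cardk m3 by (subst card_Un_disjoint) auto
      moreover have "card (A 2 \<union> (A 1 \<union> A 3)) \<le> n"
        using card_mono[of "{1..n}" "A 2 \<union> (A 1 \<union> A 3)"] sub m3 by simp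
      ultimately show ?thesis using U13 kl l2k True by linarith
    next
      case False
      then show ?thesis using U12 le12 kl l2k by linarith
    qed
  qed
  have "m < 7"
  proof (rule ccontr)
    assume "\<not> m < 7"
    then have I: "{1,2,3,5,6,7} \<subseteq> {1..m}" by auto
    \<comment> \<open>The signs cancel the constant \<open>l2\<close>, and omitting index 4 leaves
      only the four adjacent pairs of equal sign: 6a + 8b = -2a.\<close>
    define y :: "nat \<Rightarrow> int" where "y i = (if i < 4 then 1 else - 1)" for i
    have "0 \<le> (\<Sum>j\<in>{1,2,3,5,6,7}. y j * (\<Sum>i\<in>{1,2,3,5,6,7}. y i * int (card (A i \<inter> A j))))"
      using I fin by (intro Gram_quadratic_form_nonneg) auto
    also have "\<dots> = - 2 * a"
      using I by (simp add: y_def gram cardk ba) (simp add: a_def)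
    finally show False using a0 by simp
  qed
  then have m6: "m = 6" using mn \<open>n \<ge> 5\<close> by simp
  have step: "x j = x (j - 1) + x (j + 1)" if "j \<in> {1..6}" for j
  proof -
    have "a * (x j - (x (j - 1) + x (j + 1))) = 0"
      using rec[of j] that m6 ba by (simp add: algebra_simps)
    then show ?thesis using a0 by simp
  qed
  have "x 0 = 0" "x 7 = 0" using zero m6 by auto
  moreover have "x 1 = x 0 + x 2" "x 2 = x 1 + x 3" "x 3 = x 2 + x 4"
    "x 4 = x 3 + x 5" "x 5 = x 4 + x 6" "x 6 = x 5 + x 7"
    subgoal using step[of 1] by (simp add: numeral_2_eq_2)
    subgoal using step[of 2] by simp
    subgoal using step[of 3] by simp
    subgoal using step[of 4] by simp
    subgoal using step[of 5] by simp
    subgoal using step[of 6] by simp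
    done
  \<comment> \<open>From \<open>x 0 = 0\<close> the values run x1, x1, 0, -x1, -x1, 0, x1, so
    \<open>x 7 = 0\<close> gives \<open>x 1 = 0\<close>.\<close>
  ultimately have all: "x 1 = 0" "x 2 = 0" "x 3 = 0" "x 4 = 0" "x 5 = 0" "x 6 = 0"
    by linarith+
  have "p \<in> {1..6}" using p zero m6 by blast
  then have "p = 1 \<or> p = 2 \<or> p = 3 \<or> p = 4 \<or> p = 5 \<or> p = 6" by auto
  then show False using all p by auto
qed

end
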